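(* Let $\alpha,\gamma\in\mathbb{R}$. For any $\varepsilon>0$ and $N\in\mathbb{N}$, $$\#N_\gamma(\alpha,\varepsilon)\ \le\ \#N(\alpha,2\varepsilon)+1.$$ Furthermore, if $N'_\gamma(\alpha,\varepsilon')\ne\emptyset$, where $N':=\tfrac12N$ and $\varepsilon':=\tfrac12\varepsilon$, then $$\#N_\gamma(\alpha,\varepsilon)\ \ge\ \#N'(\alpha,\varepsilon')+1.$$
   Context: $\|x\|$ denotes the distance from $x\in\mathbb{R}$ to the nearest integer. For a real number $X>0$, $\alpha,\gamma\in\mathbb{R}$ and $\varepsilon>0$, $X_\gamma(\alpha,\varepsilon):=\{n\in\mathbb{N}:\|n\alpha-\gamma\|<\varepsilon,\ n\le X\}$ and $X(\alpha,\varepsilon):=X_0(\alpha,\varepsilon)$; this notation is used with $X=N$ and $X=N'$. *)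

theory Defs
  imports Complex_Main
begin

definition dist_nearest_int :: "real \<Rightarrow> real"  ("\<parallel>_\<parallel>") where
  "\<parallel>x\<parallel> = \<bar>x - of_int (round x)\<bar>"

text \<open>The natural numbers start at 1 here, so \<open>n = 0\<close> is excluded explicitly; if it were
  admitted, 0 would always lie in the homogeneous set \<open>approx_set X 0 \<alpha> \<epsilon>\<close>. The bound \<open>X\<close> is real
  because it is also used with a half-integer value.\<close>

definition approx_set :: "real \<Rightarrow> real \<Rightarrow> real \<Rightarrow> real \<Rightarrow> nat set" where
  "approx_set X \<gamma> \<alpha> \<epsilon> = {n. n \<ge> 1 \<and> \<parallel>real n * \<alpha> - \<gamma>\<parallel> < \<epsilon> \<and> real n \<le> X}"

abbreviation approx_set_hom :: "real \<Rightarrow> real \<Rightarrow> real \<Rightarrow> nat set" where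
  "approx_set_hom X \<alpha> \<epsilon> \<equiv> approx_set X 0 \<alpha> \<epsilon>"

end

theory Submission imports Defs begin

text \<open>Both bounds come from translating a set of good approximations by one of its own members.
  Subtracting two solutions of the inhomogeneous problem cancels the shift \<open>\<gamma>\<close>, and adding a
  homogeneous solution to an inhomogeneous one keeps it; the errors add up in each case because
  the distance to the nearest integer is subadditive.

  For the upper bound, translate by the least inhomogeneous solution \<open>m\<close>: every other solution
  \<open>n\<close> gives a positive \<open>n - m \<le> N\<close> with error below \<open>2 * \<epsilon>\<close>, and the summand \<open>1\<close> accounts
  for \<open>m\<close> itself. For the lower bound, translate the homogeneous solutions by an inhomogeneous
  solution \<open>m\<close>; halving both the length and the error leaves room for the sums. Since
  homogeneous solutions are positive, all these translates exceed \<open>m\<close>, so that \<open>m\<close> is one more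
  solution.\<close>

lemma dist_nearest_int_le: "\<parallel>x\<parallel> \<le> \<bar>x - of_int k\<bar>"
  unfolding dist_nearest_int_def by (rule round_diff_minimal)

lemma dist_nearest_int_add: "\<parallel>x + y\<parallel> \<le> \<parallel>x\<parallel> + \<parallel>y\<parallel>"
  using dist_nearest_int_le[of "x + y" "round x + round y"]
  unfolding dist_nearest_int_def by simp

lemma dist_nearest_int_diff: "\<parallel>x - y\<parallel> \<le> \<parallel>x\<parallel> + \<parallel>y\<parallel>"
  using dist_nearest_int_le[of "x - y" "round x - round y"]
  unfolding dist_nearest_int_def by simp

lemma finite_approx_set: "finite (approx_set X \<gamma> \<alpha> \<epsilon>)"
proof (rule finite_subset)
  show "approx_set X \<gamma> \<alpha> \<epsilon> \<subseteq> {..nat \<lfloor>X\<rfloor>}"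
    unfolding approx_set_def by (auto simp: le_nat_floor)
qed simp

lemma approx_set_mono:
  assumes "X \<le> Y" and "\<delta> \<le> \<epsilon>"
  shows "approx_set X \<gamma> \<alpha> \<delta> \<subseteq> approx_set Y \<gamma> \<alpha> \<epsilon>"
  using assms unfolding approx_set_def by auto

lemma approx_set_diff:
  assumes "n \<in> approx_set X \<gamma> \<alpha> \<delta>" and "m \<in> approx_set Y \<gamma> \<alpha> \<epsilon>" and "m < n"
  shows "n - m \<in> approx_set_hom X \<alpha> (\<delta> + \<epsilon>)"
proof -
  have "real (n - m) * \<alpha> - 0 = (real n * \<alpha> - \<gamma>) - (real m * \<alpha> - \<gamma>)"
    using assms(3) by (simp add: of_nat_diff algebra_simps)
  then show ?thesis
    using dist_nearest_int_diff[of "real n * \<alpha> - \<gamma>" "real m * \<alpha> - \<gamma>"] assms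
    unfolding approx_set_def by auto
qed

lemma approx_set_add:
  assumes "m \<in> approx_set X \<gamma> \<alpha> \<delta>" and "h \<in> approx_set_hom Y \<alpha> \<epsilon>"
  shows "m + h \<in> approx_set (X + Y) \<gamma> \<alpha> (\<delta> + \<epsilon>)"
proof -
  have "real (m + h) * \<alpha> - \<gamma> = (real m * \<alpha> - \<gamma>) + (real h * \<alpha> - 0)"
    by (simp add: algebra_simps)
  then show ?thesis
    using dist_nearest_int_add[of "real m * \<alpha> - \<gamma>" "real h * \<alpha> - 0"] assms
    unfolding approx_set_def mem_Collect_eq by (simp only: of_nat_add) linarith
qed

lemma card_approx_set_le:
  "card (approx_set X \<gamma> \<alpha> \<epsilon>) \<le> card (approx_set_hom X \<alpha> (2 * \<epsilon>)) + 1"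
proof (cases "approx_set X \<gamma> \<alpha> \<epsilon> = {}")
  case False
  let ?A = "approx_set X \<gamma> \<alpha> \<epsilon>"
  define m where "m = Min ?A"
  have m: "m \<in> ?A" and least: "\<And>n. n \<in> ?A \<Longrightarrow> m \<le> n"
    using finite_approx_set False by (simp_all add: m_def)
  have "card (?A - {m}) \<le> card (approx_set_hom X \<alpha> (2 * \<epsilon>))"
  proof (rule card_inj_on_le[where f = "\<lambda>n. n - m"])
    show "inj_on (\<lambda>n. n - m) (?A - {m})"
      by (rule inj_onI) (metis DiffD1 least eq_diff_iff)
    show "(\<lambda>n. n - m) ` (?A - {m}) \<subseteq> approx_set_hom X \<alpha> (2 * \<epsilon>)"
    proof (rule image_subsetI)
      fix n assume "n \<in> ?A - {m}"
      with least[of n] approx_set_diff[of n X \<gamma> \<alpha> \<epsilon> m X \<epsilon>] m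
      show "n - m \<in> approx_set_hom X \<alpha> (2 * \<epsilon>)" by simp
    qed
  qed (rule finite_approx_set)
  then show ?thesis using m by (simp add: card_Diff_singleton)
qed simp

lemma card_approx_set_ge:
  assumes m: "m \<in> approx_set X \<gamma> \<alpha> \<delta>" and "Y \<ge> 0" and "\<epsilon> \<ge> 0"
  shows "card (approx_set_hom Y \<alpha> \<epsilon>) + 1 \<le> card (approx_set (X + Y) \<gamma> \<alpha> (\<delta> + \<epsilon>))"
proof -
  let ?H = "approx_set_hom Y \<alpha> \<epsilon>"
  have "m \<notin> (+) m ` ?H"
    unfolding approx_set_def by auto
  then have "card (insert m ((+) m ` ?H)) = card ?H + 1"
    by (simp add: finite_approx_set card_image)
  moreover have "m \<in> approx_set (X + Y) \<gamma> \<alpha> (\<delta> + \<epsilon>)"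
    using m assms(2,3) approx_set_mono[of X "X + Y" \<delta> "\<delta> + \<epsilon>"] by auto
  then have "insert m ((+) m ` ?H) \<subseteq> approx_set (X + Y) \<gamma> \<alpha> (\<delta> + \<epsilon>)"
    using approx_set_add[OF m] by auto
  ultimately show ?thesis
    using card_mono[OF finite_approx_set] by metis
qed

theorem lemma6p3:
  fixes \<alpha> \<gamma> \<epsilon> :: real and N :: nat
  assumes "\<epsilon> > 0" and "N \<ge> 1"
  shows "card (approx_set (real N) \<gamma> \<alpha> \<epsilon>) \<le> card (approx_set_hom (real N) \<alpha> (2 * \<epsilon>)) + 1
    \<and> (approx_set (real N / 2) \<gamma> \<alpha> (\<epsilon> / 2) \<noteq> {} \<longrightarrow>
       card (approx_set (real N) \<gamma> \<alpha> \<epsilon>) \<ge> card (approx_set_hom (real N / 2) \<alpha> (\<epsilon> / 2)) + 1)"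
proof (intro conjI impI)
  show "card (approx_set (real N) \<gamma> \<alpha> \<epsilon>) \<le> card (approx_set_hom (real N) \<alpha> (2 * \<epsilon>)) + 1"
    by (rule card_approx_set_le)
next
  assume "approx_set (real N / 2) \<gamma> \<alpha> (\<epsilon> / 2) \<noteq> {}"
  then obtain m where "m \<in> approx_set (real N / 2) \<gamma> \<alpha> (\<epsilon> / 2)" by blast
  from card_approx_set_ge[OF this, of "real N / 2" "\<epsilon> / 2"] assms(1)
  show "card (approx_set (real N) \<gamma> \<alpha> \<epsilon>) \<ge> card (approx_set_hom (real N / 2) \<alpha> (\<epsilon> / 2)) + 1"
    by simp
qed

end
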